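(* Every honeycomb toroidal graph $\mathrm{HTG}(m,n,\ell)$ is hamiltonian, i.e. contains a cycle through all of its $mn$ vertices.
   Context: Honeycomb toroidal graph: let $m\ge 1$ be an integer, $n\ge 4$ an even integer, and $\ell$ an integer with $\ell\equiv m \pmod 2$. The graph $\mathrm{HTG}(m,n,\ell)$ has vertex set $\{u_{i,j}: 0\le i\le m-1,\ j\in\mathbb{Z}_n\}$ (second subscripts are taken modulo $n$; the vertices $u_{i,0},\dots,u_{i,n-1}$ form column $i$) and the following edges: vertical edges $u_{i,j}u_{i,j+1}$ for all $0\le i\le m-1$ and all $j$; flat edges $u_{i,j}u_{i+1,j}$ for $0\le i\le m-2$ and all $j$ with $i+j$ odd; jump edges $u_{m-1,j}u_{0,j+\ell}$ for all $j$ with $j\equiv m\pmod 2$. Only parameters for which this is a simple 3-regular graph are allowed (in particular, when $m=1$ one requires $\ell\not\equiv\pm1\pmod n$). *)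

theory Defs
  imports Main
begin

text \<open>Vertex u_{i,j} is represented by the pair (i, j) with i < m and j < n
  (second subscript taken modulo n).\<close>

definition htg_vertices :: "nat \<Rightarrow> nat \<Rightarrow> (nat \<times> nat) set" where
  "htg_vertices m n = {(i, j). i < m \<and> j < n}"

definition htg_vertical :: "nat \<Rightarrow> nat \<Rightarrow> int \<Rightarrow> nat \<times> nat \<Rightarrow> nat \<times> nat \<Rightarrow> bool" where
  "htg_vertical m n l u v \<longleftrightarrow>
     fst u < m \<and> snd u < n \<and> fst v = fst u \<and> snd v = (snd u + 1) mod n"

definition htg_flat :: "nat \<Rightarrow> nat \<Rightarrow> int \<Rightarrow> nat \<times> nat \<Rightarrow> nat \<times> nat \<Rightarrow> bool" where
  "htg_flat m n l u v \<longleftrightarrow>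
     fst u + 2 \<le> m \<and> snd u < n \<and> odd (fst u + snd u) \<and> fst v = fst u + 1 \<and> snd v = snd u"

definition htg_jump :: "nat \<Rightarrow> nat \<Rightarrow> int \<Rightarrow> nat \<times> nat \<Rightarrow> nat \<times> nat \<Rightarrow> bool" where
  "htg_jump m n l u v \<longleftrightarrow>
     fst u = m - 1 \<and> snd u < n \<and> even (snd u + m) \<and>
     fst v = 0 \<and> int (snd v) = (int (snd u) + l) mod int n"

definition htg_adj :: "nat \<Rightarrow> nat \<Rightarrow> int \<Rightarrow> nat \<times> nat \<Rightarrow> nat \<times> nat \<Rightarrow> bool" where
  "htg_adj m n l u v \<longleftrightarrow>
     htg_vertical m n l u v \<or> htg_vertical m n l v u \<or>
     htg_flat m n l u v \<or> htg_flat m n l v u \<or>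
     htg_jump m n l u v \<or> htg_jump m n l v u"

text \<open>Admissible parameters: m \<ge> 1, n \<ge> 4 even, l \<equiv> m (mod 2), and for m = 1
  l \<not>\<equiv> \<plusminus>1 (mod n) (so that the graph is simple and 3-regular).\<close>

definition htg_params :: "nat \<Rightarrow> nat \<Rightarrow> int \<Rightarrow> bool" where
  "htg_params m n l \<longleftrightarrow>
     m \<ge> 1 \<and> n \<ge> 4 \<and> even n \<and> even (l - int m) \<and>
     (m = 1 \<longrightarrow> l mod int n \<noteq> 1 \<and> l mod int n \<noteq> int n - 1)"

definition is_hamiltonian_cycle :: "'a set \<Rightarrow> ('a \<Rightarrow> 'a \<Rightarrow> bool) \<Rightarrow> 'a list \<Rightarrow> bool" where
  "is_hamiltonian_cycle V E vs \<longleftrightarrow>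
     distinct vs \<and> set vs = V \<and> length vs \<ge> 3 \<and>
     (\<forall>k < length vs. E (vs ! k) (vs ! ((k + 1) mod length vs)))"

definition hamiltonian :: "'a set \<Rightarrow> ('a \<Rightarrow> 'a \<Rightarrow> bool) \<Rightarrow> bool" where
  "hamiltonian V E \<longleftrightarrow> (\<exists>vs. is_hamiltonian_cycle V E vs)"

end

theory Submission
  imports Defs
begin

text \<open>The hamiltonian cycle is a connected 2-factor obtained by deleting one vertical edge per
  column along each of \<open>c\<close> disjoint strands. A strand moves up or down by 1 in every column and
  after all \<open>m\<close> columns it closes up, through the jump edges, with the strand \<open>K\<close> places further on.
  The strands cut every column into segments; a horizontal edge is kept iff a strand runs along
  it, and it joins two segments. Connectivity thus becomes a question about segments modulo \<open>c\<close>.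

  If \<open>m\<close> is even and all strands alternate up and down, the segments \<open>t\<close> and \<open>t + K\<close> of a column
  are joined, so spacing the strands \<open>2 * gcd (l / 2) (n / 2)\<close> apart makes \<open>K\<close> coprime to \<open>c\<close>. If \<open>m\<close>
  is odd, this pattern joins \<open>t\<close> with \<open>t + K - 1\<close> instead and leaves \<open>\<gamma> = gcd (K - 1) c\<close> cycles. For a
  suitable choice of strands, up to the reflection \<open>l \<mapsto> - l\<close>, the number \<open>\<gamma>\<close> is odd, and
  \<open>(\<gamma> - 1) / 2\<close> local changes, each merging three cycles into one, connect everything.\<close>

subsection \<open>Hamiltonian cycles from connected 2-regular graphs\<close>

text \<open>Take a longest path. Its first vertex has both neighbours on it, and the one that is not
  second must be last, since an inner vertex would get a third neighbour. The path closes to a cycle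
  that no edge leaves, so by connectivity it is spanning.\<close>

lemma hamiltonian_if_connected_two_regular:
  assumes fin: "finite V" and ne: "V \<noteq> {}"
    and sym: "\<And>u v. R u v \<Longrightarrow> R v u"
    and irr: "\<And>u. \<not> R u u"
    and dom: "\<And>u v. R u v \<Longrightarrow> u \<in> V"
    and deg: "\<And>u. u \<in> V \<Longrightarrow> card {v. R u v} = 2"
    and conn: "\<And>u v. u \<in> V \<Longrightarrow> v \<in> V \<Longrightarrow> R\<^sup>*\<^sup>* u v"
  shows "hamiltonian V R"
proof -
  define path where "path xs \<longleftrightarrow> xs \<noteq> [] \<and> distinct xs \<and> set xs \<subseteq> V \<and> successively R xs" for xs
  obtain v0 where "v0 \<in> V" using ne by blast
  then have ex: "path [v0]" by (simp add: path_def)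
  have bound: "length xs < Suc (card V)" if "path xs" for xs
    using that card_mono[OF fin] by (metis path_def distinct_card less_Suc_eq_le)
  obtain xs where xs: "path xs" and longest: "\<And>ys. path ys \<Longrightarrow> length ys \<le> length xs"
    using ex_has_greatest_nat[of path, OF ex] bound by (metis less_Suc_eq_le)
  define L where "L = length xs"
  have dist: "distinct xs" and sub: "set xs \<subseteq> V" and "xs \<noteq> []" and succ: "successively R xs"
    using xs by (auto simp: path_def)
  have step: "R (xs ! i) (xs ! Suc i)" if "Suc i < L" for i
    using succ that by (simp add: successively_conv_nth L_def)
  have L0: "L > 0" using \<open>xs \<noteq> []\<close> by (simp add: L_def)
  have hd_nbrs: "v \<in> set xs" if "R (xs ! 0) v" for v
  proof (rule ccontr)
    assume "v \<notin> set xs"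
    moreover have "v \<in> V" using that sym dom by blast
    ultimately have "path (v # xs)"
      using xs that sym by (cases xs) (auto simp: path_def)
    from longest[OF this] show False by simp
  qed
  have "xs ! 0 \<in> V" using sub L0 by (auto simp: L_def)
  then have "card {v. R (xs ! 0) v} = 2" by (rule deg)
  then obtain a b where ab: "{v. R (xs ! 0) v} = {a, b}" "a \<noteq> b"
    by (auto simp: card_2_iff)
  have "\<exists>j. j \<noteq> 1 \<and> j < L \<and> R (xs ! 0) (xs ! j)"
  proof -
    obtain j k where "j < L" "a = xs ! j" "k < L" "b = xs ! k"
      using hd_nbrs ab by (metis L_def in_set_conv_nth insertCI mem_Collect_eq)
    moreover from this have "R (xs ! 0) (xs ! j)" "R (xs ! 0) (xs ! k)" "j \<noteq> k"
      using ab by auto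
    ultimately show ?thesis by metis
  qed
  then obtain j where j: "j \<noteq> 1" "j < L" "R (xs ! 0) (xs ! j)" by blast
  have "j \<noteq> 0" using j irr by metis
  then have j2: "j \<ge> 2" using j by simp
  have "j = L - 1"
  proof (rule ccontr)
    assume "j \<noteq> L - 1"
    then have jL: "Suc j < L" using j by simp
    have "R (xs ! j) (xs ! Suc j)" "R (xs ! j) (xs ! 0)" using step jL j sym by auto
    moreover have "R (xs ! j) (xs ! (j - 1))" using step[of "j - 1"] j2 jL sym by simp
    ultimately have s: "{xs ! Suc j, xs ! 0, xs ! (j - 1)} \<subseteq> {v. R (xs ! j) v}" by blast
    have "xs ! Suc j \<noteq> xs ! 0" "xs ! Suc j \<noteq> xs ! (j - 1)" "xs ! 0 \<noteq> xs ! (j - 1)"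
      using dist jL j2 L0 by (simp_all add: nth_eq_iff_index_eq L_def)
    then have "card {xs ! Suc j, xs ! 0, xs ! (j - 1)} = 3"
      by simp
    moreover have "card {v. R (xs ! j) v} = 2" using deg sub jL by (simp add: L_def subset_eq)
    ultimately show False using card_mono[OF _ s] card.infinite by fastforce
  qed
  then have close: "R (xs ! (L - 1)) (xs ! 0)" and L3: "L \<ge> 3" using j j2 sym by auto
  have cyc: "R (xs ! k) (xs ! ((k + 1) mod L))" if "k < L" for k
  proof (cases "Suc k = L")
    case True
    then have "k = L - 1" by simp
    then show ?thesis using close True by simp
  next
    case False
    then show ?thesis using step[of k] that by simp
  qed
  have closed: "v \<in> set xs" if uv: "u \<in> set xs" "R u v" for u v
  proof -
    obtain i where i: "i < L" "u = xs ! i" using uv(1) by (metis in_set_conv_nth L_def)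
    define i' where "i' = (if i = 0 then L - 1 else i - 1)"
    define i'' where "i'' = (i + 1) mod L"
    have i': "i' < L" "(i' + 1) mod L = i" "i'' < L" using i L0 by (auto simp: i'_def i''_def)
    have "i' \<noteq> i''" using L3 i by (cases "Suc i = L") (auto simp: i'_def i''_def)
    then have c2: "card {xs ! i', xs ! i''} = 2"
      using i' dist by (simp add: nth_eq_iff_index_eq L_def)
    have s: "{xs ! i', xs ! i''} \<subseteq> {v. R u v}"
      using cyc[OF \<open>i < L\<close>] cyc[OF i'(1)] i' sym i by (auto simp: i''_def)
    have "card {v. R u v} = 2" using deg sub that by blast
    then have eq: "{v. R u v} = {xs ! i', xs ! i''}"
      using card_subset_eq[OF _ s] c2 card.infinite by fastforce
    moreover have "xs ! i' \<in> set xs" "xs ! i'' \<in> set xs" using i' by (simp_all add: L_def)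
    moreover have "v \<in> {xs ! i', xs ! i''}" using uv(2) unfolding eq[symmetric] by simp
    ultimately show ?thesis by auto
  qed
  have "v \<in> set xs" if "v \<in> V" for v
  proof -
    have "R\<^sup>*\<^sup>* (xs ! 0) v" using conn \<open>xs ! 0 \<in> V\<close> that by blast
    then show ?thesis by (induction rule: rtranclp_induct) (use closed L0 in \<open>auto simp: L_def\<close>)
  qed
  then show ?thesis
    unfolding hamiltonian_def is_hamiltonian_cycle_def
    using dist sub L3 cyc by (intro exI[of _ xs]) (auto simp: L_def)
qed

lemma hamiltonian_image:
  assumes "hamiltonian V E" and "inj_on f V" and "f ` V = V'"
    and "\<And>u v. u \<in> V \<Longrightarrow> v \<in> V \<Longrightarrow> E u v \<Longrightarrow> E' (f u) (f v)"
  shows "hamiltonian V' E'"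
proof -
  obtain vs where vs: "is_hamiltonian_cycle V E vs" using assms(1) by (auto simp: hamiltonian_def)
  have "E' (map f vs ! k) (map f vs ! ((k + 1) mod length vs))" if "k < length vs" for k
  proof -
    have "(k + 1) mod length vs < length vs" using that by (intro mod_less_divisor) auto
    then show ?thesis using vs that assms(4) by (auto simp: is_hamiltonian_cycle_def)
  qed
  then have "is_hamiltonian_cycle V' E' (map f vs)"
    using vs assms(2,3) by (auto simp: is_hamiltonian_cycle_def distinct_map)
  then show ?thesis by (auto simp: hamiltonian_def)
qed

subsection \<open>Honeycomb toroidal graphs in integer coordinates\<close>

text \<open>Rows are integers here, so that heights of strands and jumps need no wrap-around; only
  \<open>lift\<close> reduces modulo \<open>n\<close>.\<close>

definition lift :: "nat \<Rightarrow> nat \<Rightarrow> int \<Rightarrow> nat \<times> nat" where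
  "lift n i j = (i, nat (j mod int n))"

lemma lift_eq_iff: "n > 0 \<Longrightarrow> lift n i j = lift n i' j' \<longleftrightarrow> i = i' \<and> j mod int n = j' mod int n"
  by (auto simp: lift_def nat_eq_iff)

lemma lift_int: "j < n \<Longrightarrow> lift n i (int j) = (i, j)"
  by (simp add: lift_def)

lemma lift_mem: "n > 0 \<Longrightarrow> i < m \<Longrightarrow> lift n i j \<in> htg_vertices m n"
  by (simp add: lift_def htg_vertices_def nat_less_iff)

lemma vertex_cases:
  assumes "v \<in> htg_vertices m n"
  obtains i j where "i < m" "v = lift n i j"
proof (rule that)
  show "fst v < m" "v = lift n (fst v) (int (snd v))"
    using assms by (auto simp: htg_vertices_def lift_int)
qed

lemma htg_adj_sym: "htg_adj m n l u v \<Longrightarrow> htg_adj m n l v u"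
  by (auto simp: htg_adj_def)

lemma even_nat_mod_iff: "even n \<Longrightarrow> n > 0 \<Longrightarrow> even (nat (j mod int n)) \<longleftrightarrow> even j"
  by (simp add: even_nat_iff dvd_mod_iff)

lemma htg_adj_vertical:
  assumes "n > 0" "i < m"
  shows "htg_adj m n l (lift n i j) (lift n i (j + 1))"
proof -
  have "int ((nat (j mod int n) + 1) mod n) = (j + 1) mod int n"
    using assms by (simp add: zmod_int mod_simps add.commute)
  then have "(nat (j mod int n) + 1) mod n = nat ((j + 1) mod int n)" by linarith
  then show ?thesis
    using assms by (auto simp: htg_adj_def htg_vertical_def lift_def nat_less_iff)
qed

lemma htg_adj_flat:
  assumes "n > 0" "even n" "Suc i < m" "odd (int i + j)"
  shows "htg_adj m n l (lift n i j) (lift n (Suc i) j)"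
  using assms by (auto simp: htg_adj_def htg_flat_def lift_def nat_less_iff even_nat_mod_iff)

lemma htg_adj_jump:
  assumes "n > 0" "even n" "m > 0" "even (j + int m)"
  shows "htg_adj m n l (lift n (m - 1) j) (lift n 0 (j + l))"
  using assms by (auto simp: htg_adj_def htg_jump_def lift_def nat_less_iff even_nat_mod_iff mod_simps)

text \<open>Negating the rows preserves parity, so flat edges go to flat edges and jumps by
  \<open>- l\<close> to jumps by \<open>l\<close>.\<close>

lemma htg_reflect:
  assumes n: "n > 0" "even n" and m: "m > 0" and ham: "hamiltonian (htg_vertices m n) (htg_adj m n (- l))"
  shows "hamiltonian (htg_vertices m n) (htg_adj m n l)"
proof -
  define f where "f v = lift n (fst v) (- int (snd v))" for v :: "nat \<times> nat"
  have f: "f (lift n i j) = lift n i (- j)" for i j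
    using n by (simp add: f_def lift_def mod_simps)
  have inv: "f (f v) = v" if "v \<in> htg_vertices m n" for v
    using that by (elim vertex_cases) (simp add: f)
  have mem: "f v \<in> htg_vertices m n" if "v \<in> htg_vertices m n" for v
    using that n by (elim vertex_cases) (simp add: f lift_mem)
  have dir: "htg_adj m n l (f u) (f v)"
    if uv: "u \<in> htg_vertices m n" "v \<in> htg_vertices m n"
      and adj: "htg_vertical m n (-l) u v \<or> htg_flat m n (-l) u v \<or> htg_jump m n (-l) u v" for u v
  proof -
    obtain i j i' j' where u: "u = (i, j)" "i < m" "j < n" and v: "v = (i', j')" "i' < m" "j' < n"
      using uv by (auto simp: htg_vertices_def)
    have fu: "f u = lift n i (- int j)" and fv: "f v = lift n i' (- int j')"
      by (simp_all add: f_def u v)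
    from adj show ?thesis
    proof (elim disjE)
      assume "htg_vertical m n (-l) u v"
      then have i': "i' = i" "j' = (j + 1) mod n" by (auto simp: htg_vertical_def u v)
      have "f v = lift n i (- 1 - int j)"
        unfolding fv i' lift_def by (simp add: zmod_int mod_simps)
      then show ?thesis
        using htg_adj_vertical[of n i m l "- 1 - int j"] n u fu by (simp add: htg_adj_sym)
    next
      assume "htg_flat m n (-l) u v"
      then show ?thesis
        using htg_adj_flat[of n i m "- int j" l] n fu fv by (auto simp: htg_flat_def u v)
    next
      assume "htg_jump m n (-l) u v"
      then have *: "i' = 0" "i = m - 1" "even (j + m)" "int j' = (int j - l) mod int n"
        by (auto simp: htg_jump_def u v)
      have "f v = lift n 0 (- int j + l)"
        unfolding fv * lift_def by (simp add: mod_simps)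
      then show ?thesis
        using htg_adj_jump[of n m "- int j" l] n m fu * by simp
    qed
  qed
  have "htg_adj m n l (f u) (f v)"
    if "u \<in> htg_vertices m n" "v \<in> htg_vertices m n" "htg_adj m n (-l) u v" for u v
    using that dir[of u v] dir[of v u] htg_adj_sym unfolding htg_adj_def[of m n "-l"] by blast
  moreover have "inj_on f (htg_vertices m n)" using inv by (rule inj_on_inverseI)
  moreover have "f ` htg_vertices m n = htg_vertices m n"
    using inv mem by (metis image_eqI image_subsetI subsetI subset_antisym)
  ultimately show ?thesis using hamiltonian_image[OF ham] by blast
qed

lemma htg_hamiltonian_single_column:
  assumes "n \<ge> 4"
  shows "hamiltonian (htg_vertices 1 n) (htg_adj 1 n l)"
proof -
  have "set (map (Pair 0) [0..<n]) = htg_vertices 1 n" by (auto simp: htg_vertices_def)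
  then show ?thesis
    using assms unfolding hamiltonian_def is_hamiltonian_cycle_def
    by (intro exI[of _ "map (Pair 0) [0..<n]"])
      (auto simp: distinct_map inj_on_def htg_adj_def htg_vertical_def)
qed

subsection \<open>The 2-factor of a system of strands\<close>

text \<open>Serves to find the segment containing a given row: a strictly increasing integer
  sequence is unbounded in both directions.\<close>

lemma strict_mono_int_bracket:
  fixes f :: "int \<Rightarrow> int"
  assumes step: "\<And>t. f t < f (t + 1)"
  obtains t where "f t < j" "j \<le> f (t + 1)"
proof -
  have up: "f t + int k \<le> f (t + int k)" for t k
  proof (induction k)
    case (Suc k)
    then show ?case using step[of "t + int k"] by (simp add: algebra_simps)
  qed simp
  define a where "a = - \<bar>j - f 0\<bar> - 1"
  have "f a < j" using up[of a "nat (- a)"] by (simp add: a_def)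
  have "j \<le> f (a + int (nat (j - f a)))" using up[of a "nat (j - f a)"] \<open>f a < j\<close> by simp
  then obtain k where k: "j \<le> f (a + int k)" "\<And>k'. k' < k \<Longrightarrow> \<not> j \<le> f (a + int k')"
    using exists_least_iff[of "\<lambda>k. j \<le> f (a + int k)"] by blast
  then obtain k' where "k = Suc k'" using \<open>f a < j\<close> by (cases k) auto
  then show thesis using that[of "a + int k'"] k by (simp add: algebra_simps not_le)
qed

text \<open>\<open>h i t\<close> is the row in which strand \<open>t\<close> crosses from column
  \<open>i - 1\<close> to column \<open>i\<close>, by a jump edge if \<open>i\<close> is 0 or
  \<open>m\<close>; \<open>parity\<close> says that a horizontal edge exists there. All integers
  number the strands upwards, so \<open>t + c\<close> is strand \<open>t\<close> again after one
  turn around the column.\<close>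

locale strands =
  fixes m n :: nat and l c K :: int and h :: "nat \<Rightarrow> int \<Rightarrow> int"
  assumes m: "2 \<le> m" and n: "4 \<le> n" "even n"
    and parity: "i \<le> m \<Longrightarrow> even (h i t + int i)"
    and step: "i < m \<Longrightarrow> \<bar>h (Suc i) t - h i t\<bar> = 1"
    and mono: "i \<le> m \<Longrightarrow> h i t < h i (t + 1)"
    and period: "i \<le> m \<Longrightarrow> h i (t + c) = h i t + int n"
    and closing: "h m t + l = h 0 (t + K)"
begin

text \<open>Strand \<open>t\<close> runs along one vertical edge of column \<open>i\<close>, between
  its rows of entry and exit. This edge is deleted; \<open>low i t\<close> is its lower end.\<close>

definition low :: "nat \<Rightarrow> int \<Rightarrow> int" where
  "low i t = min (h i t) (h (Suc i) t)"

definition cut :: "nat \<Rightarrow> int \<Rightarrow> bool" where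
  "cut i j \<longleftrightarrow> j \<in> range (low i)"

definition used :: "nat \<Rightarrow> int \<Rightarrow> bool" where
  "used i j \<longleftrightarrow> j \<in> range (h i) \<or> j \<in> range (h (Suc i))"

text \<open>The other end of the horizontal edge at a vertex.\<close>

definition across :: "nat \<Rightarrow> int \<Rightarrow> nat \<times> nat" where
  "across i j =
    (if even (int i + j) then if i = 0 then lift n (m - 1) (j - l) else lift n (i - 1) j
     else if Suc i = m then lift n 0 (j + l) else lift n (Suc i) j)"

definition nbr :: "nat \<Rightarrow> int \<Rightarrow> nat \<times> nat \<Rightarrow> bool" where
  "nbr i j v \<longleftrightarrow> v = lift n i (j + 1) \<and> \<not> cut i j \<or> v = lift n i (j - 1) \<and> \<not> cut i (j - 1)
     \<or> v = across i j \<and> used i j"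

definition R :: "nat \<times> nat \<Rightarrow> nat \<times> nat \<Rightarrow> bool" where
  "R u v \<longleftrightarrow> (\<exists>i j. i < m \<and> u = lift n i j \<and> nbr i j v)"

lemma across_odd: "odd (int i + j) \<Longrightarrow>
    across i j = (if Suc i = m then lift n 0 (j + l) else lift n (Suc i) j)"
  by (simp add: across_def)

lemma n0: "n > 0" using n by simp

text \<open>Heights on one boundary have equal parity, so strands are at least 2 apart there and
  deleted edges share no vertex.\<close>

lemma low_gap: "i < m \<Longrightarrow> low i t + 1 < low i (t + 1)"
  using step[of i t] step[of i "t + 1"] mono[of i t] mono[of "Suc i" t]
    parity[of i t] parity[of i "t + 1"] parity[of "Suc i" t] parity[of "Suc i" "t + 1"]
  unfolding low_def by simp presburger

lemma low_mono:
  assumes "i < m" "s < t"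
  shows "low i s + 1 < low i t"
  using \<open>s < t\<close>
proof (induction t rule: int_gr_induct)
  case base
  show ?case using low_gap assms by simp
next
  case (step t)
  then show ?case using low_gap[OF assms(1), of t] by simp
qed

lemma low_period: "i < m \<Longrightarrow> low i (t + c) = low i t + int n"
  by (simp add: low_def period min_def)

text \<open>The rows where a strand enters and leaves a column are the two ends of the edge it
  deletes, so a vertex gains its horizontal edge exactly when it loses a vertical one.\<close>

lemma used_iff: "i < m \<Longrightarrow> used i j \<longleftrightarrow> cut i j \<or> cut i (j - 1)"
proof -
  assume i: "i < m"
  have "j = h i t \<or> j = h (Suc i) t \<longleftrightarrow> j = low i t \<or> j - 1 = low i t" for t
    using step[OF i, of t] unfolding low_def by arith
  then show ?thesis unfolding used_def cut_def image_iff by blast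
qed

lemma not_cut_both: "i < m \<Longrightarrow> \<not> (cut i j \<and> cut i (j - 1))"
proof
  assume i: "i < m" and "cut i j \<and> cut i (j - 1)"
  then obtain s t where "low i t = j" "low i s = j - 1" by (auto simp: cut_def)
  moreover from this have "s < t \<or> t < s" by (metis diff_0_right diff_left_imp_eq linorder_neqE_linordered_idom zero_neq_one)
  ultimately show False using low_mono[OF i, of s t] low_mono[OF i, of t s] by auto
qed

lemma shift_invariant:
  fixes f :: "int \<Rightarrow> 'a"
  assumes "\<And>j. f (j + int n) = f j" and "j mod int n = j' mod int n"
  shows "f j = f j'"
proof -
  have nat: "f (j + int k * int n) = f j" for j k
  proof (induction k)
    case (Suc k)
    then show ?case using assms(1)[of "j + int k * int n"] by (simp add: algebra_simps)
  qed simp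
  have all: "f (j + q * int n) = f j" for j q
    using nat[of j "nat q"] nat[of "j + q * int n" "nat (- q)"] by (cases "q \<ge> 0") auto
  have "f j = f (j mod int n)" for j
    using all[of "j mod int n" "j div int n"] by simp
  then show ?thesis using assms(2) by metis
qed

lemma range_period:
  fixes f :: "int \<Rightarrow> int"
  assumes "\<And>t. f (t + c) = f t + int n"
  shows "j + int n \<in> range f \<longleftrightarrow> j \<in> range f"
proof
  assume "j + int n \<in> range f"
  then obtain t where "j + int n = f t" by blast
  then have "j = f (t - c)" using assms[of "t - c"] by simp
  then show "j \<in> range f" by blast
next
  assume "j \<in> range f"
  then obtain t where "j = f t" by blast
  then have "j + int n = f (t + c)" using assms by simp
  then show "j + int n \<in> range f" by blast
qed

lemma cut_period: "i < m \<Longrightarrow> cut i (j + int n) = cut i j"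
  unfolding cut_def by (intro range_period low_period)

lemma nbr_period: "i < m \<Longrightarrow> nbr i (j + int n) = nbr i j"
proof -
  assume i: "i < m"
  have L: "lift n i' (j + int n) = lift n i' j" for i' j by (simp add: lift_def)
  have "lift n i (j + int n + 1) = lift n i (j + 1)" "lift n i (j + int n - 1) = lift n i (j - 1)"
    using L[of i "j + 1"] L[of i "j - 1"] by (simp_all add: algebra_simps)
  moreover have "across i (j + int n) = across i j"
    using L[of 0 "j + l"] L[of "m - 1" "j - l"] L n by (simp add: across_def algebra_simps)
  moreover have "cut i (j + int n - 1) = cut i (j - 1)"
    using cut_period[OF i, of "j - 1"] by (simp add: algebra_simps)
  ultimately show ?thesis
    using i by (auto simp: nbr_def fun_eq_iff used_iff cut_period)
qed

lemma R_lift: "i < m \<Longrightarrow> R (lift n i j) v \<longleftrightarrow> nbr i j v"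
proof
  assume i: "i < m" and "R (lift n i j) v"
  then obtain j' where "nbr i j' v" "j mod int n = j' mod int n"
    using n0 by (auto simp: R_def lift_eq_iff)
  then show "nbr i j v" using shift_invariant[of "nbr i" j j'] nbr_period i by metis
qed (auto simp: R_def)

lemma lift_neq: "lift n i (j + 1) \<noteq> lift n i (j - 1)"
proof
  assume "lift n i (j + 1) = lift n i (j - 1)"
  then have "int n dvd (j + 1) - (j - 1)" using n0 by (simp add: lift_eq_iff mod_eq_dvd_iff)
  then show False using n zdvd_imp_le[of "int n" 2] by simp
qed

lemma across_column: "i < m \<Longrightarrow> fst (across i j) \<noteq> i \<and> fst (across i j) < m"
  using m by (auto simp: across_def lift_def)

text \<open>By \<open>used_iff\<close> and \<open>not_cut_both\<close> a vertex keeps both vertical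
  edges or trades exactly one for the horizontal edge.\<close>

lemma R_degree:
  assumes "u \<in> htg_vertices m n"
  shows "card {v. R u v} = 2"
proof -
  obtain i j where i: "i < m" and u: "u = lift n i j" using vertex_cases[OF assms] .
  have ne: "across i j \<noteq> lift n i j'" for j' using across_column[OF i] by (metis fst_conv lift_def)
  note ne = ne[of "j + 1"] ne[of "j - 1"] lift_neq[of i j]
  have "{v. R u v} = {v. nbr i j v}" using R_lift i u by simp
  moreover consider "cut i j" "\<not> cut i (j - 1)" "used i j" | "\<not> cut i j" "cut i (j - 1)" "used i j"
    | "\<not> cut i j" "\<not> cut i (j - 1)" "\<not> used i j"
    using used_iff not_cut_both i by blast
  then have "card {v. nbr i j v} = 2"
  proof cases
    case 1
    then have "{v. nbr i j v} = {lift n i (j - 1), across i j}" by (auto simp: nbr_def)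
    then show ?thesis using ne by simp
  next
    case 2
    then have "{v. nbr i j v} = {lift n i (j + 1), across i j}" by (auto simp: nbr_def)
    then show ?thesis using ne by simp
  next
    case 3
    then have "{v. nbr i j v} = {lift n i (j + 1), lift n i (j - 1)}" by (auto simp: nbr_def)
    then show ?thesis using ne by simp
  qed
  ultimately show ?thesis by simp
qed

lemma used_cases:
  assumes "i < m" "used i j"
  obtains t where "j = h i t" "even (int i + j)" | t where "j = h (Suc i) t" "odd (int i + j)"
  using assms parity[of i] parity[of "Suc i"] unfolding used_def
  by (auto simp: add.commute)

text \<open>A kept horizontal edge is kept from both ends; for jump edges this is
  \<open>closing\<close>, where strand \<open>t - K\<close> continues as strand
  \<open>t\<close>.\<close>

lemma across_across:
  assumes i: "i < m" and u: "used i j"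
  obtains i' j' where "i' < m" "across i j = lift n i' j'" "used i' j'" "across i' j' = lift n i j"
    and "htg_adj m n l (lift n i j) (lift n i' j')"
  using i u
proof (cases rule: used_cases)
  case (1 t)
  show ?thesis
  proof (cases "i = 0")
    case True
    have j': "j - l = h m (t - K)" using closing[of "t - K"] 1 True by simp
    have par: "even (j - l + int m)" using parity[of m "t - K"] j' by simp
    have odd: "odd (int (m - 1) + (j - l))" using par m by (simp add: of_nat_diff)
    show ?thesis
    proof (rule that[of "m - 1" "j - l"])
      show "used (m - 1) (j - l)" using j' m by (auto simp: used_def)
      show "across (m - 1) (j - l) = lift n i j" using m True unfolding across_odd[OF odd] by simp
      show "htg_adj m n l (lift n i j) (lift n (m - 1) (j - l))"
        using htg_adj_jump[of n m "j - l" l] n0 n m par True by (simp add: htg_adj_sym)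
    qed (use m 1 True in \<open>auto simp: across_def\<close>)
  next
    case False
    then obtain i' where i': "i = Suc i'" by (cases i) auto
    have "odd (int i' + j)" using 1(2) unfolding i' by presburger
    show ?thesis
    proof (rule that[of i' j])
      show "htg_adj m n l (lift n i j) (lift n i' j)"
        using htg_adj_sym[OF htg_adj_flat[of n i' m j l]] n0 n i \<open>odd (int i' + j)\<close> by (simp add: i')
    qed (use i 1 i' in \<open>auto simp: across_def used_def\<close>)
  qed
next
  case (2 t)
  show ?thesis
  proof (cases "Suc i = m")
    case True
    have j': "j + l = h 0 (t + K)" using closing[of t] 2 True by simp
    have par: "even (j + l)" using parity[of 0 "t + K"] j' by simp
    show ?thesis
    proof (rule that[of 0 "j + l"])
      show "used 0 (j + l)" using j' by (auto simp: used_def)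
      show "across 0 (j + l) = lift n i j" using par True by (auto simp: across_def)
      show "htg_adj m n l (lift n i j) (lift n 0 (j + l))"
        using htg_adj_jump[of n m j l] n0 n m 2 True by auto
    qed (use m 2 True in \<open>auto simp: across_def\<close>)
  next
    case False
    show ?thesis
    proof (rule that[of "Suc i" j])
      show "htg_adj m n l (lift n i j) (lift n (Suc i) j)"
        using htg_adj_flat[of n i m j l] n0 n i 2 False by simp
    qed (use i 2 False in \<open>auto simp: across_def used_def\<close>)
  qed
qed

lemma R_sym_adj:
  assumes "R u v"
  shows "R v u" and "htg_adj m n l u v" and "u \<noteq> v"
proof -
  obtain i j where i: "i < m" and u: "u = lift n i j" and nb: "nbr i j v"
    using assms by (auto simp: R_def)
  have "R v u \<and> htg_adj m n l u v \<and> u \<noteq> v"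
    using nb unfolding nbr_def
  proof (elim disjE conjE)
    assume "v = lift n i (j + 1)" "\<not> cut i j"
    moreover have "lift n i j \<noteq> lift n i (j + 1)"
      using n n0 by (auto simp: lift_eq_iff mod_eq_dvd_iff)
    ultimately show ?thesis
      using i u n0 htg_adj_vertical by (auto simp: R_lift nbr_def)
  next
    assume "v = lift n i (j - 1)" "\<not> cut i (j - 1)"
    moreover have "lift n i j \<noteq> lift n i (j - 1)"
      using n n0 by (auto simp: lift_eq_iff mod_eq_dvd_iff)
    ultimately show ?thesis
      using i u n0 htg_adj_vertical[of n i m l "j - 1"] by (auto simp: R_lift nbr_def htg_adj_sym)
  next
    assume v: "v = across i j" and us: "used i j"
    have "u \<noteq> v" using across_column[OF i] v u by (metis fst_conv lift_def)
    then show ?thesis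
      using across_across[OF i us] v u by (metis R_lift nbr_def)
  qed
  then show "R v u" "htg_adj m n l u v" "u \<noteq> v" by auto
qed

section \<open>Segments of columns and their connections\<close>

definition segment :: "nat \<Rightarrow> int \<Rightarrow> nat \<times> nat" where
  "segment i t = lift n i (low i (t + 1))"

definition joined :: "nat \<times> nat \<Rightarrow> nat \<times> nat \<Rightarrow> bool" (infix "\<sim>" 50) where
  "u \<sim> v \<longleftrightarrow> R\<^sup>*\<^sup>* u v"

lemma joined_refl [simp, intro!]: "u \<sim> u" by (simp add: joined_def)
lemma joined_trans [trans]: "u \<sim> v \<Longrightarrow> v \<sim> w \<Longrightarrow> u \<sim> w"
  by (auto simp: joined_def)
lemma joined_sym: "u \<sim> v \<Longrightarrow> v \<sim> u"
  unfolding joined_def using R_sym_adj(1) by (metis rtranclp_converseI conversep_iff sympI symp_rtranclp sympD)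

lemma joined_R: "R u v \<Longrightarrow> u \<sim> v"
  by (auto simp: joined_def)

text \<open>No edge strictly between two consecutive deleted ones is missing, so every row there is
  connected to the top vertex, which represents the segment.\<close>

lemma joined_segment:
  assumes i: "i < m" and "low i t < j" "j \<le> low i (t + 1)"
  shows "lift n i j \<sim> segment i t"
  using assms(3,2)
proof (induction j rule: int_le_induct)
  case base
  show ?case by (simp add: segment_def)
next
  case (step j)
  have "\<not> cut i (j - 1)"
  proof
    assume "cut i (j - 1)"
    then obtain s where s: "low i s = j - 1" by (auto simp: cut_def)
    have "\<not> s \<le> t" using s step low_mono[OF i, of s t] by (cases "s = t") auto
    moreover have "\<not> t + 1 \<le> s" using s step low_mono[OF i, of "t + 1" s] by (cases "s = t + 1") auto
    ultimately show False by simp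
  qed
  then have "R (lift n i (j - 1)) (lift n i j)" using i by (simp add: R_lift nbr_def)
  then have "lift n i (j - 1) \<sim> lift n i j" by (rule joined_R)
  also have "\<dots> \<sim> segment i t" using step by simp
  finally show ?case .
qed

lemma segment_period: "i < m \<Longrightarrow> segment i (t + c) = segment i t"
  using low_period[of i "t + 1"] by (simp add: segment_def lift_def algebra_simps)

lemma segment_mod: "i < m \<Longrightarrow> segment i (t mod c) = segment i t"
proof -
  assume i: "i < m"
  have nat: "segment i (t + int k * c) = segment i t" for t k
  proof (induction k)
    case (Suc k)
    then show ?case using segment_period[OF i, of "t + int k * c"] by (simp add: algebra_simps)
  qed simp
  have "segment i (t + q * c) = segment i t" for t q
    using nat[of t "nat q"] nat[of "t + q * c" "nat (- q)"] by (cases "q \<ge> 0") auto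
  from this[of "t mod c" "t div c"] show ?thesis by simp
qed

text \<open>A strand rising through column \<open>i\<close> enters at the top end of the segment below it
  and leaves at the bottom end of the segment above it.\<close>

definition enter :: "nat \<Rightarrow> int \<Rightarrow> int" where
  "enter i t = (if h i t < h (Suc i) t then t - 1 else t)"

definition leave :: "nat \<Rightarrow> int \<Rightarrow> int" where
  "leave i t = (if h i t < h (Suc i) t then t else t - 1)"

lemma joined_enter:
  assumes "i < m" shows "lift n i (h i t) \<sim> segment i (enter i t)"
  using assms step[of i t] low_gap[of i t] low_gap[of i "t - 1"]
  by (intro joined_segment) (auto simp: enter_def low_def)

lemma joined_leave:
  assumes "i < m" shows "lift n i (h (Suc i) t) \<sim> segment i (leave i t)"
  using assms step[of i t] low_gap[of i t] low_gap[of i "t - 1"]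
  by (intro joined_segment) (auto simp: leave_def low_def)

text \<open>The flat edge along strand \<open>t\<close> between the two columns has its ends in
  these segments.\<close>

lemma joined_flat:
  assumes "Suc i < m" shows "segment i (leave i t) \<sim> segment (Suc i) (enter (Suc i) t)"
proof -
  have "odd (int i + h (Suc i) t)" using parity[of "Suc i" t] assms by simp
  then have "across i (h (Suc i) t) = lift n (Suc i) (h (Suc i) t)" using assms by (simp add: across_def)
  then have "R (lift n i (h (Suc i) t)) (lift n (Suc i) (h (Suc i) t))"
    using assms by (auto simp: R_lift nbr_def used_def)
  then show ?thesis
    using joined_enter[OF assms, of t] joined_leave[of i t] assms
    by (meson Suc_lessD joined_R joined_sym joined_trans)
qed

lemma joined_jump: "segment (m - 1) (leave (m - 1) t) \<sim> segment 0 (enter 0 (t + K))"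
proof -
  have m': "Suc (m - 1) = m" "m - 1 < m" "0 < m" using m by auto
  have "odd (int (m - 1) + h m t)" using parity[of m t] m by (simp add: of_nat_diff)
  then have "across (m - 1) (h m t) = lift n 0 (h 0 (t + K))"
    using m' closing[of t] by (simp add: across_def)
  then have "R (lift n (m - 1) (h m t)) (lift n 0 (h 0 (t + K)))"
    using m' by (auto simp: R_lift nbr_def used_def)
  then show ?thesis
    using joined_enter[OF m'(3), of "t + K"] joined_leave[OF m'(2), of t]
    unfolding m'(1) by (meson joined_R joined_sym joined_trans)
qed

lemma hamiltonian_if_joined:
  assumes "\<And>i t. i < m \<Longrightarrow> segment i t \<sim> v0"
  shows "hamiltonian (htg_vertices m n) (htg_adj m n l)"
proof -
  have all: "u \<sim> v0" if u': "u \<in> htg_vertices m n" for u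
  proof -
    obtain i j where i: "i < m" and u: "u = lift n i j" using vertex_cases[OF u'] .
    have "low i t < low i (t + 1)" for t using low_gap[OF i, of t] by simp
    then obtain t where "low i t < j" "j \<le> low i (t + 1)" using strict_mono_int_bracket by metis
    then show ?thesis using joined_segment[OF i] assms[OF i] joined_trans u by blast
  qed
  have "hamiltonian (htg_vertices m n) R"
  proof (rule hamiltonian_if_connected_two_regular)
    have "htg_vertices m n = {..<m} \<times> {..<n}" by (auto simp: htg_vertices_def)
    then show "finite (htg_vertices m n)" "htg_vertices m n \<noteq> {}" using m n0
      by (auto simp: lessThan_empty_iff)
    show "u \<in> htg_vertices m n" if "R u v" for u v
      using that n0 by (auto simp: R_def lift_mem)
    show "R\<^sup>*\<^sup>* u v" if "u \<in> htg_vertices m n" "v \<in> htg_vertices m n" for u v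
      using all that joined_sym joined_trans unfolding joined_def by blast
  qed (use R_sym_adj R_degree in blast)+
  then show ?thesis
    by (rule hamiltonian_image[where f = "\<lambda>u. u"]) (auto intro: R_sym_adj)
qed

end

subsection \<open>Connectivity of the 2-factor\<close>

lemma linear_congruence_nat:
  fixes u c t :: int
  assumes "c > 0" and "gcd u c dvd t"
  obtains k :: nat where "(int k * u) mod c = t mod c"
proof -
  obtain x y where xy: "x * u + y * c = gcd u c" using bezout_int by blast
  obtain q where "t = gcd u c * q" using assms(2) by (elim dvdE)
  then have "(x * q) * u = t + c * (- (y * q))" using xy by (simp add: algebra_simps flip: xy)
  \<comment> \<open>Reducing the Bezout coefficient modulo \<open>c\<close> makes it nonnegative, so
    that multiples of \<open>u\<close> can be reached by induction.\<close>
  then have "((x * q) mod c * u) mod c = t mod c" by (metis mod_mult_left_eq mod_mult_self2)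
  then show thesis using that[of "nat ((x * q) mod c)"] assms(1) by simp
qed

lemma mod_Suc_int:
  fixes t c :: int
  assumes "c > 0"
  shows "(t + 1) mod c = (if t mod c + 1 = c then 0 else t mod c + 1)"
proof -
  have "(t + 1) mod c = (t mod c + 1) mod c" by (simp add: mod_simps)
  moreover have "0 \<le> t mod c" "t mod c < c" using assms by simp_all
  ultimately show ?thesis by (cases "t mod c + 1 = c") (simp_all add: mod_pos_pos_trivial)
qed

text \<open>A strand of shape 0, 1 or 2 makes the steps \<open>+-+\<close>, \<open>++-\<close> or \<open>-++\<close> in the first three
  columns. All strands of shape 0 would give \<open>\<gamma>\<close> cycles, one for each residue class of segments
  modulo \<open>\<gamma>\<close>; each pair of neighbouring strands of shapes 1 and 2 merges three of them into one.\<close>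

definition shape :: "int \<Rightarrow> int \<Rightarrow> int \<Rightarrow> nat" where
  "shape \<gamma> c t = (if t mod c < \<gamma> \<and> t mod c > 0 then if odd (t mod c) then 1 else 2 else 0)"

text \<open>Height above a baseline \<open>w\<close>. Shapes 0, 1 and 2 begin with 0 1 0 1, with 0 1
  2 1 and with 0 -1 0 1; they agree from boundary 3 on, so a change of shape is local.\<close>

definition offset :: "nat \<Rightarrow> nat \<Rightarrow> int" where
  "offset s i = (if i = 1 \<and> s = 2 then - 1 else if i = 2 \<and> s = 1 then 2 else int (i mod 2))"

lemma shape_cong: "t mod c = t' mod c \<Longrightarrow> shape \<gamma> c t = shape \<gamma> c t'"
  by (simp add: shape_def)

lemma shape_le_2: "shape \<gamma> c t \<le> 2"
  by (simp add: shape_def)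

text \<open>As \<open>\<gamma>\<close> is odd, the residues from 1 to \<open>\<gamma> - 1\<close>
  split into pairs of an odd number and its successor. So strands of shapes 1 and 2 always come as
  neighbours, and only between them is extra room required.\<close>

lemma shape_Suc_eq_2_iff:
  assumes "c > 0" "\<gamma> \<le> c" "odd \<gamma>"
  shows "shape \<gamma> c (t + 1) = 2 \<longleftrightarrow> shape \<gamma> c t = 1"
proof -
  have "0 \<le> t mod c" "t mod c < c" using assms by simp_all
  moreover have "t mod c + 1 \<noteq> \<gamma>" if "odd (t mod c)" using that assms(3) by auto
  moreover have "t mod c > 0" if "odd (t mod c)" using that \<open>0 \<le> t mod c\<close> by (cases "t mod c = 0") auto
  ultimately show ?thesis using assms by (auto simp: shape_def mod_Suc_int)
qed

lemma shape_beyond: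
  assumes "c > 0" "\<gamma> \<le> c" "odd \<gamma>" "\<gamma> \<le> t mod c"
  shows "shape \<gamma> c t = 0" "shape \<gamma> c (t + 1) = 0"
  using assms by (auto simp: shape_def mod_Suc_int)

lemma shape_small:
  assumes "0 \<le> r" "r < \<gamma>" "\<gamma> \<le> c"
  shows "shape \<gamma> c r = (if r = 0 then 0 else if odd r then 1 else 2)"
  using assms by (simp add: shape_def mod_pos_pos_trivial)

lemma shape_gamma:
  assumes "0 < \<gamma>" "\<gamma> \<le> c"
  shows "shape \<gamma> c \<gamma> = 0"
  using assms by (cases "\<gamma> = c") (simp_all add: shape_def mod_pos_pos_trivial)

section \<open>Connecting all segments, for even and for odd \<open>m\<close>\<close>

context strands
begin

lemma segment_cong: "i < m \<Longrightarrow> t mod c = t' mod c \<Longrightarrow> segment i t = segment i t'"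
  using segment_mod by metis

text \<open>Where strands alternate, segment numbers persist from column to column: a strand that
  rises and then falls joins the two segments above it, one that falls and then rises joins the two
  below it.\<close>

lemma joined_tail:
  assumes "i0 \<le> i" "i < m"
    and h: "\<And>i t. i0 \<le> i \<Longrightarrow> i \<le> m \<Longrightarrow> h i t = w t + int (i mod 2)"
  shows "segment i t \<sim> segment i0 t"
  using assms(1,2)
proof (induction i rule: dec_induct)
  case (step i)
  have "segment i (leave i s) \<sim> segment (Suc i) (enter (Suc i) s)" for s
    using joined_flat step by simp
  from this[of t] this[of "t + 1"] have "segment i t \<sim> segment (Suc i) t"
    using h[of i] h[of "Suc i"] h[of "Suc (Suc i)"] step
    by (cases "even i") (simp_all add: leave_def enter_def odd_iff_mod_2_eq_one even_iff_mod_2_eq_zero mod_Suc)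
  from joined_trans[OF joined_sym[OF this]] show ?case using step by simp
qed simp

lemma hamiltonian_even:
  assumes "even m" and c: "c > 0" and "gcd K c = 1"
    and h: "\<And>i t. i \<le> m \<Longrightarrow> h i t = w t + int (i mod 2)"
  shows "hamiltonian (htg_vertices m n) (htg_adj m n l)"
proof (rule hamiltonian_if_joined)
  \<comment> \<open>For even \<open>m\<close> strands fall in column \<open>m - 1\<close> and rise
    in column 0, so the jump edge of strand \<open>t + 1\<close> joins the segments below it,
    numbered \<open>t\<close> and \<open>t + K\<close>.\<close>
  have shift: "segment 0 (t + K) \<sim> segment 0 t" for t
  proof -
    obtain m' where m': "m = Suc m'" "odd m'" using \<open>even m\<close> m by (cases m) auto
    have "leave (m - 1) (t + 1) = t" "enter 0 (t + 1 + K) = t + K"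
      using h[of m'] h[of m] h[of 0] h[of 1] m m'
      by (simp_all add: leave_def enter_def odd_iff_mod_2_eq_one)
    then have "segment (m - 1) t \<sim> segment 0 (t + K)" using joined_jump[of "t + 1"] by simp
    moreover have "segment (m - 1) t \<sim> segment 0 t" using joined_tail[of 0 "m - 1" w t] h m by simp
    ultimately show ?thesis using joined_sym joined_trans by meson
  qed
  have mult: "segment 0 (int k * K) \<sim> segment 0 0" for k
  proof (induction k)
    case (Suc k)
    have "segment 0 (int (Suc k) * K) \<sim> segment 0 (int k * K)"
      using shift[of "int k * K"] by (simp add: algebra_simps)
    then show ?case using Suc by (rule joined_trans)
  qed simp
  show "segment i t \<sim> segment 0 0" if "i < m" for i t
  proof -
    obtain k where k: "int k * K mod c = t mod c"
      using linear_congruence_nat[of c K t] c assms by auto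
    have "segment 0 t = segment 0 (int k * K)"
      using segment_mod[of 0 t] segment_mod[of 0 "int k * K"] k m by simp
    moreover have "segment i t \<sim> segment 0 t" using joined_tail[of 0 i w t] h that by simp
    ultimately show ?thesis using mult[of k] joined_trans by simp
  qed
qed

text \<open>At residues from \<open>\<gamma>\<close> on the pattern is unmodified and
  \<open>q\<close> advances by \<open>u\<close>. This leaves one arc for each residue below
  \<open>\<gamma>\<close>; strands of shape 2 join neighbouring arcs in column 0, strands of shape 1
  in column 2, and the remaining segments are attached at the end.\<close>

lemma hamiltonian_odd:
  assumes "odd m" and c: "c > 0" and \<gamma>: "\<gamma> = gcd (K - 1) c" "odd \<gamma>"
    and h: "\<And>i t. i \<le> m \<Longrightarrow> h i t = w t + offset (shape \<gamma> c t) i"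
  shows "hamiltonian (htg_vertices m n) (htg_adj m n l)"
proof -
  define T where "T = shape \<gamma> c"
  define u where "u = K - 1"
  have m3: "3 \<le> m" using m \<open>odd m\<close> by (cases "m = 2") auto
  have \<gamma>0: "0 < \<gamma>" "\<gamma> \<le> c" using c by (auto simp: \<gamma> gcd_le2_int)
  have T_le: "T t \<le> 2" for t by (simp add: T_def shape_le_2)
  have hT: "h 0 t = w t" "h 1 t = w t + (if T t = 2 then - 1 else 1)"
    "h 2 t = w t + (if T t = 1 then 2 else 0)" "h 3 t = w t + 1" for t
    using h[of 0 t] h[of 1 t] h[of 2 t] h[of 3 t] m3 by (auto simp: offset_def T_def)
  have rise: "h 0 t < h 1 t \<longleftrightarrow> T t \<noteq> 2" "h 1 t < h 2 t \<longleftrightarrow> T t \<noteq> 0" "h 2 t < h 3 t \<longleftrightarrow> T t \<noteq> 1" for t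
    using T_le[of t] hT[of t] by auto
  have Suc: "Suc 0 = 1" "Suc 1 = 2" "Suc 2 = 3" by simp_all
  have bends: "leave 0 t = (if T t = 2 then t - 1 else t)" "enter 0 t = (if T t = 2 then t else t - 1)"
    "leave (Suc 0) t = (if T t = 0 then t - 1 else t)" "enter (Suc 0) t = (if T t = 0 then t else t - 1)"
    "leave 2 t = (if T t = 1 then t - 1 else t)" "enter 2 t = (if T t = 1 then t else t - 1)"
    "leave (Suc (Suc 0)) t = (if T t = 1 then t - 1 else t)"
    "enter (Suc (Suc 0)) t = (if T t = 1 then t else t - 1)" for t
    by (simp_all only: leave_def enter_def Suc rise if_not_P not_not if_cancel split: if_split) auto
  have link0: "segment 0 (if T t = 2 then t - 1 else t) \<sim> segment 1 (if T t = 0 then t else t - 1)" for t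
    using joined_flat[of 0 t] m3 by (simp add: bends)
  have link1: "segment 1 (if T t = 0 then t - 1 else t) \<sim> segment 2 (if T t = 1 then t else t - 1)" for t
    using joined_flat[of 1 t] m3 by (simp add: bends flip: numeral_2_eq_2)
  \<comment> \<open>The segment from which strand \<open>t\<close> leaves column 2; from column 3 on
    it continues as segment number \<open>t\<close>.\<close>
  define q where "q t = segment 2 (if T t = 1 then t - 1 else t)" for t
  have q_cong: "q t = q t'" if "t mod c = t' mod c" for t t'
  proof -
    have "(t - 1) mod c = (t' - 1) mod c" using that by (rule mod_diff_cong) simp
    then show ?thesis
      using segment_cong[of 2 t t'] segment_cong[of 2 "t - 1" "t' - 1"] that m3
        shape_cong[OF that, of \<gamma>] by (simp add: q_def T_def)
  qed
  have tail: "segment i t \<sim> q t" if i: "3 \<le> i" "i < m" for i t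
  proof -
    have hi: "h i t = w t + int (i mod 2)" if "3 \<le> i" "i \<le> m" for i t
      using h[of i t] that by (simp add: offset_def)
    have "h 3 t = w t + 1" "h 4 t = w t" using hi[of 3] hi[of 4] i by auto
    then have "q t \<sim> segment 3 t"
      using joined_flat[of 2 t] i by (simp add: bends q_def enter_def split: if_splits)
    then show ?thesis using joined_tail[OF i, of w t] hi joined_sym joined_trans by blast
  qed
  \<comment> \<open>Strand \<open>t + K\<close> normally rises in column 0 and so starts in the
    segment below it, which gives the shift \<open>u = K - 1\<close>; with shape 2 it falls and
    starts in the segment above.\<close>
  have jump: "q t \<sim> segment 0 (if T (t + K) = 2 then t + K else t + K - 1)" for t
  proof -
    have "q t \<sim> segment (m - 1) (leave (m - 1) t)"
    proof (cases "m = 3")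
      case True
      then have "m - 1 = 2" by simp
      then show ?thesis by (simp add: bends q_def)
    next
      case False
      obtain m' where m': "m = Suc m'" using m by (cases m) auto
      then have "even m'" "4 \<le> m'" using False m3 \<open>odd m\<close> by auto
      then have "leave (m - 1) t = t"
        using h[of m' t] h[of m t] m' odd_iff_mod_2_eq_one[of m] \<open>odd m\<close>
        by (simp add: leave_def offset_def)
      then show ?thesis using tail[of "m - 1" t] joined_sym m' \<open>4 \<le> m'\<close> by simp
    qed
    also have "\<dots> \<sim> segment 0 (enter 0 (t + K))" by (rule joined_jump)
    finally show ?thesis by (simp add: bends)
  qed
  have T_beyond: "T s = 0" "T (s + 1) = 0" if "\<gamma> \<le> s mod c" for s
    using shape_beyond[OF c \<gamma>0(2) \<gamma>(2) that] by (simp_all add: T_def)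
  have beyond: "segment 0 s \<sim> q s" "segment 1 s \<sim> q s" "q (s - u) \<sim> q s" if "\<gamma> \<le> s mod c" for s
  proof -
    note T = T_beyond[OF that]
    show 1: "segment 1 s \<sim> q s" using link1[of "s + 1"] T by (simp add: q_def)
    show 0: "segment 0 s \<sim> q s" using link0[of s] T joined_trans[OF _ 1] by simp
    show "q (s - u) \<sim> q s" using jump[of "s - u"] T joined_trans[OF _ 0] by (simp add: u_def)
  qed
  \<comment> \<open>Steps of \<open>u\<close> from \<open>a\<close> meet only unmodified residues
    until the first return below \<open>\<gamma>\<close>. Since \<open>\<gamma>\<close> divides
    \<open>u\<close> and \<open>c\<close>, this return is to \<open>a\<close> itself, and the arc
    ends one step earlier, at \<open>a - u\<close>.\<close>
  have arc: "q a \<sim> q (a - u)" if a: "0 \<le> a" "a < \<gamma>" for a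
  proof -
    define ret where "ret k \<longleftrightarrow> k > 0 \<and> (a + int k * u) mod c < \<gamma>" for k
    have "a mod c = a" using a \<gamma>0 by simp
    then have "ret (nat c)" using c a by (simp add: ret_def)
    then obtain k where k: "ret k" "\<And>k'. k' < k \<Longrightarrow> \<not> ret k'"
      using exists_least_iff[of ret] by blast
    have before: "q a \<sim> q (a + int k' * u)" if "k' < k" for k'
      using that
    proof (induction k')
      case (Suc k')
      have "\<gamma> \<le> (a + int (Suc k') * u) mod c" using k(2)[OF Suc.prems] by (simp add: ret_def)
      from beyond(3)[OF this] have "q (a + int k' * u) \<sim> q (a + int (Suc k') * u)"
        by (simp add: algebra_simps)
      with Suc show ?case using joined_trans by simp
    qed simp
    have "k > 0" using k by (simp add: ret_def)
    then have "q a \<sim> q (a + int (k - 1) * u)" by (intro before) simp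
    also have "q (a + int (k - 1) * u) = q (a - u)"
    proof (rule q_cong)
      let ?s = "a + int k * u"
      have "\<gamma> dvd c" "\<gamma> dvd u" by (simp_all add: \<gamma>(1) u_def)
      then have "\<gamma> dvd ?s - a" by simp
      then have "?s mod \<gamma> = a mod \<gamma>" by (simp only: mod_eq_dvd_iff)
      then have "?s mod c mod \<gamma> = a mod \<gamma>" using \<open>\<gamma> dvd c\<close> by (simp only: mod_mod_cancel)
      moreover have "?s mod c mod \<gamma> = ?s mod c" using k c by (simp add: ret_def)
      ultimately have "?s mod c = a mod c" using a \<open>a mod c = a\<close> by simp
      then have "(?s - u) mod c = (a - u) mod c" by (rule mod_diff_cong) simp
      then show "(a + int (k - 1) * u) mod c = (a - u) mod c"
        using \<open>k > 0\<close> by (simp add: of_nat_diff algebra_simps)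
    qed
    finally show ?thesis .
  qed
  have T_small: "T r = (if r = 0 then 0 else if odd r then 1 else 2)" if "0 \<le> r" "r < \<gamma>" for r
    using shape_small[OF that \<gamma>0(2)] by (simp add: T_def)
  have T_\<gamma>: "T \<gamma> = 0" using shape_gamma[OF \<gamma>0] by (simp add: T_def)
  have odd_less: "r + 1 < \<gamma>" if "odd r" "r < \<gamma>" for r
    using that \<gamma>(2) by (cases "r + 1 = \<gamma>") auto
  have T_next: "T (r + 1) \<noteq> 2" "r + 1 < \<gamma> \<Longrightarrow> T (r + 1) = 1" if "0 \<le> r" "r < \<gamma>" "even r" for r
    using T_small[of "r + 1"] T_\<gamma> that by (cases "r + 1 = \<gamma>"; simp)+
  \<comment> \<open>For odd \<open>r\<close>, strand \<open>r + 1\<close> has shape 2, so the arcs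
    of \<open>r\<close> and \<open>r + 1\<close> both arrive in segment \<open>r + 1\<close> of
    column 0. For even \<open>r\<close>, strand \<open>r + 1\<close> has shape 1 and falls in column
    2, so \<open>q (r + 1)\<close> and \<open>q r\<close> are the same segment.\<close>
  have q_small: "q r \<sim> q 0" if "0 \<le> r" "r < \<gamma>" for r
    using that
  proof (induction r rule: int_ge_induct)
    case (step r)
    show ?case
    proof (cases "odd r")
      case True
      have "T (r + 1) = 2" using T_small[of "r + 1"] step True by simp
      then have "q (r - u) \<sim> segment 0 (r + 1)" using jump[of "r - u"] by (simp add: u_def)
      moreover have "q (r + 1 - u) \<sim> segment 0 (r + 1)"
        using jump[of "r + 1 - u"] T_next(1)[of "r + 1"] step True by (simp add: u_def add.commute)
      moreover have "q (r + 1) \<sim> q (r + 1 - u)" "q r \<sim> q (r - u)" "q r \<sim> q 0"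
        using arc step by simp_all
      ultimately show ?thesis using joined_sym joined_trans by meson
    next
      case False
      then have "q (r + 1) = q r" using T_next(2)[of r] T_small[of r] step by (simp add: q_def)
      then show ?thesis using step by simp
    qed
  qed simp
  have q_all: "q t \<sim> q 0" for t
  proof -
    define a where "a = t mod \<gamma>"
    have a: "0 \<le> a" "a < \<gamma>" using \<gamma>0 by (simp_all add: a_def)
    have "gcd u c dvd t - a" by (simp add: a_def \<gamma> u_def minus_mod_eq_mult_div)
    then obtain k where "(int k * u) mod c = (t - a) mod c" using linear_congruence_nat c by blast
    then have "(a + int k * u) mod c = (a + (t - a)) mod c" by (rule mod_add_cong[OF refl])
    then have "q t = q (a + int k * u)" by (intro q_cong) simp
    moreover have "q (a + int k * u) \<sim> q 0" for k
    proof (induction k)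
      case 0
      then show ?case using q_small a by simp
    next
      case (Suc k)
      let ?s = "a + int (Suc k) * u"
      show ?case
      proof (cases "?s mod c < \<gamma>")
        case True
        have "q ?s = q (?s mod c)" by (rule q_cong) simp
        then show ?thesis using q_small[of "?s mod c"] True c by simp
      next
        case False
        then have "q (a + int k * u) \<sim> q ?s" using beyond(3)[of ?s] by (simp add: algebra_simps)
        then show ?thesis using Suc joined_sym joined_trans by blast
      qed
    qed
    ultimately show ?thesis by simp
  qed
  \<comment> \<open>The strands \<open>r\<close> and \<open>r + 1\<close>, of shapes 1 and 2, tie
    together three consecutive segments of column 1.\<close>
  have pair: "segment 1 (r - 1) \<sim> segment 1 r" "segment 0 r \<sim> segment 1 r" "segment 2 r \<sim> segment 1 r"
      "segment 1 (r + 1) \<sim> segment 1 r" if r: "0 \<le> r" "r < \<gamma>" "odd r" for r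
  proof -
    have T: "T r = 1" "T (r + 1) = 2" using T_small[of r] T_small[of "r + 1"] odd_less r by auto
    show 01: "segment 0 r \<sim> segment 1 r" using link0[of "r + 1"] T by simp
    have "segment 0 r \<sim> segment 1 (r - 1)" using link0[of r] T by simp
    then show "segment 1 (r - 1) \<sim> segment 1 r" using 01 joined_sym joined_trans by meson
    show "segment 2 r \<sim> segment 1 r" using link1[of r] T joined_sym by simp
    then show "segment 1 (r + 1) \<sim> segment 1 r" using link1[of "r + 1"] T joined_trans by simp
  qed
  have middle_0: "segment 1 r \<sim> segment 1 0" if "0 \<le> r" "r < \<gamma>" for r
    using that
  proof (induction r rule: int_ge_induct)
    case (step r)
    have "segment 1 (r + 1) \<sim> segment 1 r"
      using pair(4)[of r] pair(1)[of "r + 1"] step joined_sym by (cases "odd r") auto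
    then show ?case using step joined_trans by simp
  qed simp
  \<comment> \<open>Here column 1 is attached to \<open>q\<close>: strand \<open>\<gamma>\<close>
    has shape 0, and strand \<open>\<gamma> - 1\<close> does not have shape 1 because
    \<open>\<gamma> - 1\<close> is even.\<close>
  have "segment 1 (\<gamma> - 1) \<sim> segment 2 (\<gamma> - 1)" using link1[of \<gamma>] T_\<gamma> by simp
  also have "segment 2 (\<gamma> - 1) = q (\<gamma> - 1)" using T_small[of "\<gamma> - 1"] \<gamma>0 \<gamma>(2) by (simp add: q_def)
  finally have "segment 1 0 \<sim> q 0"
    using middle_0[of "\<gamma> - 1"] \<gamma>0 q_all joined_sym joined_trans by (metis diff_add_cancel less_add_one zle_diff1_eq zless_imp_add1_zle)
  then have middle: "segment 1 r \<sim> q 0" if "0 \<le> r" "r < \<gamma>" for r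
    using middle_0[OF that] joined_trans by blast
  show ?thesis
  proof (rule hamiltonian_if_joined)
    fix i t assume i: "i < m"
    define r where "r = t mod c"
    show "segment i t \<sim> q 0"
    proof (cases "3 \<le> i")
      case True
      then show ?thesis using tail[of i t] i q_all joined_trans by blast
    next
      case False
      then have i012: "i = 0 \<or> i = 1 \<or> i = 2" by auto
      show ?thesis
      proof (cases "r < \<gamma>")
        case beyond': False
        then have "segment 2 t = q t" using T_beyond(1)[of t] by (simp add: r_def q_def)
        then have "segment i t \<sim> q t" using i012 beyond[of t] beyond' by (auto simp: r_def)
        then show ?thesis using q_all joined_trans by blast
      next
        case True
        have r: "0 \<le> r" "r < \<gamma>" using True c by (simp_all add: r_def)
        have "segment i r \<sim> q 0"
        proof (cases "odd r")
          case odd: True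
          then show ?thesis using pair(2,3)[of r] r middle[OF r] i012 joined_trans by blast
        next
          case even: False
          have "q r = segment 2 r" using T_small[OF r] even by (simp add: q_def)
          then have "segment 2 r \<sim> q 0" using q_all[of r] by simp
          moreover have "segment 0 r \<sim> q 0"
          proof (cases "r = 0")
            case True
            then have "segment 0 r \<sim> segment 1 r" using link0[of 0] T_small[of 0] \<gamma>0 by simp
            then show ?thesis using middle[OF r] joined_trans by blast
          next
            case False
            then have "T r = 2" using T_small[OF r] even by simp
            then have "q (r - K) \<sim> segment 0 r" using jump[of "r - K"] by simp
            then show ?thesis using q_all joined_sym joined_trans by blast
          qed
          ultimately show ?thesis using middle[OF r] i012 by blast
        qed
        moreover have "segment i r = segment i t" unfolding r_def by (rule segment_mod[OF i])
        ultimately show ?thesis by simp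
      qed
    qed
  qed
qed

end

subsection \<open>Choice of the strands\<close>

lemma hamiltonian_even_columns:
  assumes "even m" "2 \<le> m" "4 \<le> n" "even n" "even l"
  shows "hamiltonian (htg_vertices m n) (htg_adj m n l)"
proof -
  obtain k where l: "l = 2 * k" using \<open>even l\<close> by (elim evenE)
  obtain N where n: "n = 2 * N" using \<open>even n\<close> by (elim evenE)
  define g where "g = gcd k (int N)"
  have g0: "g > 0" using n \<open>4 \<le> n\<close> by (simp add: g_def)
  obtain K c where K: "k = g * K" and c: "int N = g * c"
    by (metis g_def gcd_dvd1 gcd_dvd2 dvdE)
  have "0 < g * c" using c n \<open>4 \<le> n\<close> by simp
  then have "c > 0" using g0 by (simp add: zero_less_mult_iff)
  have "g * gcd K c = g" using g_def K c g0 by (metis abs_of_pos gcd_mult_distrib_int)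
  then have cop: "gcd K c = 1" using g0 by simp
  define h where "h i t = 2 * g * t + int (i mod 2)" for i t
  interpret strands m n l c K h
  proof
    show "even (h i t + int i)" for i t by (simp add: h_def)
    show "\<bar>h (Suc i) t - h i t\<bar> = 1" for i t by (simp add: h_def mod_Suc)
    show "h i t < h i (t + 1)" for i t using g0 by (simp add: h_def algebra_simps)
    show "h i (t + c) = h i t + int n" for i t using c n by (simp add: h_def algebra_simps)
    show "h m t + l = h 0 (t + K)" for t using \<open>even m\<close> l K by (simp add: h_def algebra_simps)
  qed (use assms in auto)
  show ?thesis by (rule hamiltonian_even) (use assms \<open>c > 0\<close> cop in \<open>auto simp: h_def\<close>)
qed

section \<open>Strands for an odd number of columns\<close>

lemma offset_step: "s \<le> 2 \<Longrightarrow> \<bar>offset s (Suc i) - offset s i\<bar> = 1"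
  by (auto simp: offset_def mod_Suc)

lemma even_offset: "even (offset s i + int i)"
  by (simp add: offset_def)

text \<open>Leaves only the baseline \<open>w\<close> to be chosen. The 1 in
  \<open>w_closing\<close> is the offset at the odd boundary \<open>m\<close>. The gap of 4 is there
  because a strand of shape 1 and the one of shape 2 above it come 2 closer at boundaries 1 and
  2.\<close>

lemma hamiltonian_odd_columns:
  fixes w :: "int \<Rightarrow> int"
  assumes columns: "odd m" "3 \<le> m" and rows: "4 \<le> n" "even n"
    and c: "c > 0" and \<gamma>: "\<gamma> = gcd (K - 1) c" "odd \<gamma>"
    and w: "\<And>t. even (w t)" "\<And>t. w t < w (t + 1)" "\<And>t. shape \<gamma> c t = 1 \<Longrightarrow> w t + 4 \<le> w (t + 1)"
    and w_period: "\<And>t. w (t + c) = w t + int n" and w_closing: "\<And>t. w t + l + 1 = w (t + K)"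
  shows "hamiltonian (htg_vertices m n) (htg_adj m n l)"
proof -
  define h where "h i t = w t + offset (shape \<gamma> c t) i" for i t
  have "\<gamma> \<le> c" using c by (simp add: \<gamma> gcd_le2_int)
  interpret strands m n l c K h
  proof
    show "even (h i t + int i)" for i t
      using w(1)[of t] even_offset[of "shape \<gamma> c t" i] by (simp add: h_def add.assoc)
    show "\<bar>h (Suc i) t - h i t\<bar> = 1" for i t
      using offset_step[OF shape_le_2] by (simp add: h_def)
    show "h i t < h i (t + 1)" for i t
    proof -
      have "w t + 2 \<le> w (t + 1)" using w(1,2)[of t] w(1)[of "t + 1"] by presburger
      moreover have "shape \<gamma> c (t + 1) = 2 \<longleftrightarrow> shape \<gamma> c t = 1"
        using shape_Suc_eq_2_iff c \<open>\<gamma> \<le> c\<close> \<gamma>(2) by blast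
      ultimately show ?thesis
        using w(3)[of t] by (auto simp: h_def offset_def)
    qed
    show "h i (t + c) = h i t + int n" for i t
      using w_period[of t] shape_cong[of "t + c" c t \<gamma>] by (simp add: h_def)
    show "h m t + l = h 0 (t + K)" for t
      using w_closing[of t] columns by (simp add: h_def offset_def odd_iff_mod_2_eq_one)
  qed (use columns rows in auto)
  show ?thesis by (rule hamiltonian_odd[OF columns(1) c \<gamma>]) (simp add: h_def)
qed

text \<open>If \<open>k - 1\<close> is coprime to \<open>N\<close>, strands 2 apart give
  \<open>\<gamma> = 1\<close> and need no local change. If \<open>g = gcd k N\<close> is at least 3,
  gaps of \<open>2\<close> and \<open>2 * g - 2\<close> alternate: the wide gaps leave room for
  local changes, and \<open>K = 2 * k'\<close> is even, which makes \<open>\<gamma>\<close>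
  odd.\<close>

lemma hamiltonian_odd_shift:
  fixes k :: int
  assumes m: "odd m" "3 \<le> m" and n: "4 \<le> n" "n = 2 * N"
    and k: "gcd k (int N) \<ge> 3 \<or> gcd (k - 1) (int N) = 1"
  shows "hamiltonian (htg_vertices m n) (htg_adj m n (2 * k - 1))"
  using k
proof
  assume cop: "gcd (k - 1) (int N) = 1"
  show ?thesis
    by (rule hamiltonian_odd_columns[where w = "\<lambda>t. 2 * t" and c = "int N" and K = k and \<gamma> = 1])
      (use m n cop in \<open>auto simp: shape_def split: if_splits\<close>)
next
  define g where "g = gcd k (int N)"
  assume "gcd k (int N) \<ge> 3"
  then have g3: "g \<ge> 3" by (simp add: g_def)
  obtain k' c where k': "k = g * k'" and c: "int N = g * c"
    by (metis g_def gcd_dvd1 gcd_dvd2 dvdE)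
  have "0 < g * c" using n c by simp
  then have c0: "c > 0" using g3 by (simp add: zero_less_mult_iff)
  define w where "w t = 2 * g * (t div 2) + 2 * (t mod 2)" for t :: int
  have w_even: "w (2 * s) = 2 * g * s" and w_odd: "w (2 * s + 1) = 2 * g * s + 2" for s
    by (simp_all add: w_def)
  have w_shift: "w (t + 2 * s) = w t + 2 * g * s" for t s
    by (simp add: w_def algebra_simps)
  let ?\<gamma> = "gcd (2 * k' - 1) (2 * c)"
  show ?thesis
  proof (rule hamiltonian_odd_columns[OF m n(1)])
    show "odd ?\<gamma>" by (metis dvd_trans dvd_diff_right_iff dvd_triv_left gcd_dvd1 odd_one)
    show "even (w t)" for t by (simp add: w_def)
    show "w t < w (t + 1)" for t
    proof (cases "even t")
      case True
      then obtain s where "t = 2 * s" by (elim evenE)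
      then show ?thesis by (simp only: w_even w_odd)
    next
      case False
      then obtain s where "t = 2 * s + 1" by (elim oddE)
      then show ?thesis using w_even[of "s + 1"] w_odd[of s] g3 by (simp add: algebra_simps)
    qed
    show "w t + 4 \<le> w (t + 1)" if "shape ?\<gamma> (2 * c) t = 1" for t
    proof -
      \<comment> \<open>Reduction modulo \<open>2 * c\<close> keeps parity, so every strand of shape
        1 has a wide gap above it.\<close>
      have "odd t" using that by (auto simp: shape_def dvd_mod_iff split: if_splits)
      then obtain s where "t = 2 * s + 1" by (elim oddE)
      then show ?thesis using w_even[of "s + 1"] w_odd[of s] g3 by (simp add: algebra_simps)
    qed
    show "w (t + 2 * c) = w t + int n" for t using c n by (simp add: w_shift)
    show "w t + (2 * k - 1) + 1 = w (t + 2 * k')" for t using k' by (simp add: w_shift)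
  qed (use n c0 in auto)
qed

theorem theorem4p1:
  fixes m n :: nat and l :: int
  assumes "htg_params m n l"
  shows "hamiltonian (htg_vertices m n) (htg_adj m n l)"
proof -
  have m: "1 \<le> m" and n: "4 \<le> n" "even n" and lm: "even (l - int m)"
    using assms by (auto simp: htg_params_def)
  consider "m = 1" | "even m" "2 \<le> m" | "odd m" "3 \<le> m"
    using m by (cases "m = 1"; cases "m = 2"; force)
  then show ?thesis
  proof cases
    case 1
    then show ?thesis using htg_hamiltonian_single_column n by simp
  next
    case 2
    then show ?thesis using hamiltonian_even_columns n lm by simp
  next
    case 3
    obtain N where N: "n = 2 * N" using n(2) by (elim evenE)
    have "even (l + 1)" using lm 3 by simp
    then obtain k where "l + 1 = 2 * k" by (elim evenE)
    then have k: "l = 2 * k - 1" by simp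
    define a b where "a = gcd k (int N)" and "b = gcd (k - 1) (int N)"
    have ab: "a > 0" "b > 0" using N n by (auto simp: a_def b_def)
    \<comment> \<open>\<open>a\<close> and \<open>b\<close> divide the consecutive integers
      \<open>k\<close> and \<open>k - 1\<close>, so they cannot both be even.\<close>
    have "\<not> (a = 2 \<and> b = 2)"
      by (metis a_def b_def gcd_dvd1 dvd_diff_right_iff odd_one)
    then consider "a \<ge> 3 \<or> b = 1" | "b \<ge> 3 \<or> a = 1" using ab by linarith
    then show ?thesis
    proof cases
      case 1
      then show ?thesis using hamiltonian_odd_shift[OF 3 n(1) N] by (simp add: a_def b_def k)
    next
      case 2
      \<comment> \<open>Reflection turns \<open>l\<close> into \<open>- l\<close> and
        \<open>k\<close> into \<open>1 - k\<close>, which exchanges \<open>a\<close> and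
        \<open>b\<close>.\<close>
      have "gcd (1 - k) (int N) = b" using gcd_neg1_int[of "k - 1" "int N"] by (simp add: b_def)
      moreover have "gcd (1 - k - 1) (int N) = a" by (simp add: a_def)
      ultimately have "hamiltonian (htg_vertices m n) (htg_adj m n (2 * (1 - k) - 1))"
        using hamiltonian_odd_shift[OF 3 n(1) N, of "1 - k"] 2 by simp
      moreover have "2 * (1 - k) - 1 = - l" using k by simp
      ultimately show ?thesis using htg_reflect[of n m l] n m by simp
    qed
  qed
qed

end
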